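(* Let $\alpha=\beta=\gamma=\delta>0$ (the rhombus). The set of all configurations $(x,y,z,w)\in(\mathbb{R}\cup\{\infty\})^4$ of the planar 4-bar linkage with bar lengths $\alpha,\beta,\gamma,\delta$ is the union of the following three branches, each diffeomorphic to a circle $S^1$: (1) $\{(x,\,1/x,\,x,\,1/x) : x\in\mathbb{R}\cup\{\infty\}\}$; (2) $\{(x,\,\infty,\,-x,\,\infty) : x\in\mathbb{R}\cup\{\infty\}\}$; (3) $\{(\infty,\,y,\,\infty,\,-y) : y\in\mathbb{R}\cup\{\infty\}\}$.
   Context: $\mathbb{R}\cup\{\infty\}$ is the one-point compactification of $\mathbb{R}$, with the conventions $1/0=\infty$, $1/\infty=0$, $-\infty=\infty$. A planar 4-bar linkage has bar lengths $\alpha,\beta,\gamma,\delta>0$ in counter-clockwise cyclic order. Its configurations are described by rotational angles $\rho_x,\rho_y,\rho_z,\rho_w\in\mathbb{R}/2\pi\mathbb{Z}$, the (exterior) turning angles from bar $\alpha$ to $\beta$, from $\beta$ to $\gamma$, from $\gamma$ to $\delta$, and from $\delta$ to $\alpha$, respectively, when the closed quadrilateral is traversed once. Thus a quadruple of angles is a configuration if and only if $\rho_x+\rho_y+\rho_z+\rho_w\equiv 0 \pmod{2\pi}$ and $\beta+\gamma e^{i\rho_y}+\delta e^{i(\rho_y+\rho_z)}+\alpha e^{i(\rho_y+\rho_z+\rho_w)}=0$ (self-intersections and overlaps of bars are allowed). One writes $x=\tan\frac{\rho_x}{2}$, $y=\tan\frac{\rho_y}{2}$, $z=\tan\frac{\rho_z}{2}$,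 $w=\tan\frac{\rho_w}{2}$, with value $\infty$ when the angle is $\pi$, and identifies a configuration with $(x,y,z,w)\in(\mathbb{R}\cup\{\infty\})^4$. *)

theory Defs
  imports "HOL-Analysis.Analysis" "HOL-Library.Real_Mod"
begin

section \<open>The one-point compactification of the real line\<close>

text \<open>The point \<open>None\<close> is \<open>\<infinity>\<close>, as in the library's \<^const>\<open>Alexandroff_compactification\<close>.\<close>

type_synonym proj_real = "real option"

abbreviation infpt :: proj_real where
  "infpt \<equiv> None"

fun inv_pt :: "proj_real \<Rightarrow> proj_real" where
  "inv_pt None = Some 0"
| "inv_pt (Some x) = (if x = 0 then None else Some (1 / x))"

fun neg_pt :: "proj_real \<Rightarrow> proj_real" where
  "neg_pt None = None"
| "neg_pt (Some x) = Some (- x)"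


section \<open>Configurations of a planar 4-bar linkage\<close>

text \<open>The value is \<open>\<infinity>\<close> exactly if \<open>\<rho> \<equiv> \<pi>\<close> modulo \<open>2\<pi>\<close>; it depends on \<open>\<rho>\<close> only modulo
  \<open>2\<pi>\<close>, so that angles in \<open>\<real>/2\<pi>\<int>\<close> can be represented by real numbers below.\<close>

definition half_tan :: "real \<Rightarrow> proj_real" where
  "half_tan \<rho> = (if [\<rho> = pi] (rmod 2 * pi) then infpt else Some (tan (\<rho> / 2)))"

lemma half_tan_cong: "[\<rho> = \<rho>'] (rmod 2 * pi) \<Longrightarrow> half_tan \<rho> = half_tan \<rho>'"
proof -
  assume a: "[\<rho> = \<rho>'] (rmod 2 * pi)"
  then obtain k :: int where k: "\<rho> = \<rho>' + of_int k * (2 * pi)"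
    by (metis rcong_altdef rcong_sym)
  then have "\<rho> / 2 = \<rho>' / 2 + of_int k * pi" by (simp add: field_simps)
  then have "tan (\<rho> / 2) = tan (\<rho>' / 2)"
    by (metis tan_periodic_int)
  then show ?thesis using a by (auto simp: half_tan_def rcong_def)
qed

definition is_configuration_angles ::
  "real \<Rightarrow> real \<Rightarrow> real \<Rightarrow> real \<Rightarrow> real \<Rightarrow> real \<Rightarrow> real \<Rightarrow> real \<Rightarrow> bool" where
  "is_configuration_angles \<alpha> \<beta> \<gamma> \<delta> \<rho>x \<rho>y \<rho>z \<rho>w \<longleftrightarrow>
     [\<rho>x + \<rho>y + \<rho>z + \<rho>w = 0] (rmod 2 * pi) \<and>
     of_real \<beta> + of_real \<gamma> * cis \<rho>y + of_real \<delta> * cis (\<rho>y + \<rho>z)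
       + of_real \<alpha> * cis (\<rho>y + \<rho>z + \<rho>w) = (0 :: complex)"

definition configurations ::
  "real \<Rightarrow> real \<Rightarrow> real \<Rightarrow> real \<Rightarrow> (proj_real \<times> proj_real \<times> proj_real \<times> proj_real) set" where
  "configurations \<alpha> \<beta> \<gamma> \<delta> =
     {(half_tan \<rho>x, half_tan \<rho>y, half_tan \<rho>z, half_tan \<rho>w) | \<rho>x \<rho>y \<rho>z \<rho>w.
        is_configuration_angles \<alpha> \<beta> \<gamma> \<delta> \<rho>x \<rho>y \<rho>z \<rho>w}"


section \<open>Smooth maps and diffeomorphisms\<close>

text \<open>\<open>C\<^sup>k\<close> maps on an open set \<open>S\<close>, via iterated directional derivatives.\<close>

primrec Ck_on :: "nat \<Rightarrow> ('a::euclidean_space \<Rightarrow> 'b::euclidean_space) \<Rightarrow> 'a set \<Rightarrow> bool" where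
  "Ck_on 0 f S \<longleftrightarrow> continuous_on S f"
| "Ck_on (Suc k) f S \<longleftrightarrow>
     (\<forall>x\<in>S. f differentiable (at x)) \<and> (\<forall>v. Ck_on k (\<lambda>x. frechet_derivative f (at x) v) S)"

definition smooth_on :: "('a::euclidean_space \<Rightarrow> 'b::euclidean_space) \<Rightarrow> 'a set \<Rightarrow> bool" where
  "smooth_on f S \<longleftrightarrow> (\<forall>k. Ck_on k f S)"

text \<open>A smooth structure is given by an atlas, a set of charts \<open>(U, \<phi>)\<close> with domain \<open>U\<close>.\<close>

type_synonym ('m, 'e) chart = "'m set \<times> ('m \<Rightarrow> 'e)"

definition euclidean_atlas :: "('e, 'e) chart set" where
  "euclidean_atlas = {(UNIV, id)}"

definition prod_atlas ::
  "('m, 'e) chart set \<Rightarrow> ('n, 'f) chart set \<Rightarrow> ('m \<times> 'n, 'e \<times> 'f) chart set" where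
  "prod_atlas \<A> \<B> = {(U \<times> V, map_prod \<phi> \<psi>) | U \<phi> V \<psi>. (U, \<phi>) \<in> \<A> \<and> (V, \<psi>) \<in> \<B>}"

text \<open>Smoothness of a map on an arbitrary subset \<open>A\<close> of a manifold: near each point of \<open>A\<close> it is the
  restriction of a smooth map defined on an open set of the ambient manifold. If \<open>A\<close> is a
  submanifold, this is smoothness with respect to the induced structure.\<close>

definition smooth_map_on ::
  "('m, 'e::euclidean_space) chart set \<Rightarrow> ('n, 'f::euclidean_space) chart set \<Rightarrow>
   'm set \<Rightarrow> ('m \<Rightarrow> 'n) \<Rightarrow> bool" where
  "smooth_map_on \<A> \<B> A f \<longleftrightarrow>
     (\<forall>p\<in>A. \<exists>U \<phi> V \<psi> W F.
        (U, \<phi>) \<in> \<A> \<and> p \<in> U \<and> (V, \<psi>) \<in> \<B> \<and> f p \<in> V \<and>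
        open W \<and> \<phi> p \<in> W \<and> smooth_on F W \<and>
        (\<forall>q\<in>A \<inter> U. \<phi> q \<in> W \<longrightarrow> f q \<in> V \<and> \<psi> (f q) = F (\<phi> q)))"

definition diffeomorphic_subsets ::
  "('m, 'e::euclidean_space) chart set \<Rightarrow> 'm set \<Rightarrow>
   ('n, 'f::euclidean_space) chart set \<Rightarrow> 'n set \<Rightarrow> bool" where
  "diffeomorphic_subsets \<A> A \<B> B \<longleftrightarrow>
     (\<exists>f g. smooth_map_on \<A> \<B> A f \<and> smooth_map_on \<B> \<A> B g \<and>
        f ` A = B \<and> g ` B = A \<and> (\<forall>p\<in>A. g (f p) = p) \<and> (\<forall>q\<in>B. f (g q) = q))"


section \<open>The smooth structure of the compactified line\<close>

text \<open>The affine charts \<open>x\<close> and \<open>1/x\<close> of the projective line.\<close>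

definition fin_chart :: "(proj_real, real) chart" where
  "fin_chart = (- {infpt}, the)"

definition inf_chart :: "(proj_real, real) chart" where
  "inf_chart = (- {Some 0}, the \<circ> inv_pt)"

definition line_atlas :: "(proj_real, real) chart set" where
  "line_atlas = {fin_chart, inf_chart}"

text \<open>The charts are homeomorphisms for the topology of the one-point compactification, and their
  transition map is smooth.\<close>

abbreviation line_top :: "proj_real topology" where
  "line_top \<equiv> Alexandroff_compactification euclidean"

lemma inv_pt_inv_pt [simp]: "inv_pt (inv_pt p) = p"
  by (cases p) auto

lemma continuous_map_inv_pt: "continuous_map line_top line_top inv_pt"
proof -
  have le: "\<bar>x\<bar> \<le> 1 / e" if "1 / x \<notin> ball 0 e" "e > 0" for x e :: real
  proof -
    have "e \<le> 1 / \<bar>x\<bar>" "x \<noteq> 0" using that by auto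
    then show ?thesis using that by (simp add: field_simps)
  qed
  have opn: "openin line_top {p. inv_pt p \<in> U}" if U: "openin line_top U" for U
  proof -
    let ?N = "\<lambda>V. {x::real. x \<noteq> 0 \<and> 1 / x \<in> V}"
    have oN: "open (?N V)" if "open V" for V
    proof -
      have "?N V = (\<lambda>x. 1 / x) -` V \<inter> (- {0})" by auto
      moreover have "continuous_on (- {0}) (\<lambda>x::real. 1 / x)" by (auto intro!: continuous_intros)
      ultimately show ?thesis
        using that by (metis continuous_on_open_vimage open_Compl closed_singleton)
    qed
    from U consider V where "open V" "U = Some ` V"
      | C where "compact C" "closed C" "U = insert None (Some ` (- C))"
      by (auto simp: openin_Alexandroff_compactification Compl_eq_Diff_UNIV)
    then show ?thesis
    proof cases
      case 1
      show ?thesis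
      proof (cases "0 \<in> V")
        case False
        then have "{p. inv_pt p \<in> U} = Some ` ?N V"
          unfolding 1 using False
          by (intro set_eqI, rename_tac p, case_tac p) (auto simp: image_iff)
        then show ?thesis using oN[OF 1(1)] by simp
      next
        case True
        then obtain e where e: "e > 0" "ball 0 e \<subseteq> V"
          using 1(1) open_contains_ball by blast
        have eq: "{p. inv_pt p \<in> U} = insert None (Some ` (UNIV - (- ?N V)))"
          unfolding 1 using True
          by (intro set_eqI, rename_tac p, case_tac p) (auto simp: image_iff)
        have "- ?N V \<subseteq> cball 0 (1 / e)"
        proof
          fix x assume "x \<in> - ?N V"
          then have "x = 0 \<or> 1 / x \<notin> ball 0 e" using e(2) by blast
          then show "x \<in> cball 0 (1 / e)"
            using le e(1) by auto
        qed
        then have "bounded (- ?N V)" by (meson bounded_cball bounded_subset)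
        moreover have "closed (- ?N V)" using oN[OF 1(1)] by (simp add: closed_Compl)
        ultimately have "compact (- ?N V)" by (simp add: compact_eq_bounded_closed)
        then show ?thesis unfolding eq openin_Alexandroff_compactification
          using \<open>closed (- ?N V)\<close> by (intro disjI2 exI[of _ "- ?N V"]) auto
      qed
    next
      case 2
      obtain B where B: "B > 0" "C \<subseteq> cball 0 B"
        using bounded_subset_ballD[OF compact_imp_bounded[OF 2(1)], of 0] ball_subset_cball by blast
      have eq: "{p. inv_pt p \<in> U} = Some ` (insert 0 (?N (- C)))" if "0 \<in> C"
        unfolding 2 using that
          by (intro set_eqI, rename_tac p, case_tac p) (auto simp: image_iff)
      have eq': "{p. inv_pt p \<in> U} = insert None (Some ` (UNIV - (- insert 0 (?N (- C)))))" if "0 \<notin> C"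
        unfolding 2 using that
          by (intro set_eqI, rename_tac p, case_tac p) (auto simp: image_iff)
      have "insert 0 (?N (- C)) = ?N (- C) \<union> ball 0 (1 / B)"
      proof -
        have "1 / x \<notin> C" if "x \<noteq> 0" "\<bar>x\<bar> < 1 / B" for x
        proof
          assume "1 / x \<in> C"
          then have "\<bar>1 / x\<bar> \<le> B" using B by auto
          then show False using that B by (simp add: field_simps abs_if split: if_splits)
        qed
        then show ?thesis using B by auto
      qed
      then have o: "open (insert 0 (?N (- C)))"
        using oN[of "- C"] 2(2) by (simp add: open_Compl open_Un)
      show ?thesis
      proof (cases "0 \<in> C")
        case True
        show ?thesis
          unfolding eq[OF True] openin_Alexandroff_compactification_image_Some using o by simp
      next
        case False
        then obtain e where e: "e > 0" "ball 0 e \<subseteq> - C"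
          using 2(2) by (meson ComplI open_Compl open_contains_ball)
        have "- insert 0 (?N (- C)) \<subseteq> cball 0 (1 / e)"
        proof
          fix x assume "x \<in> - insert 0 (?N (- C))"
          then have "x \<noteq> 0" "1 / x \<notin> ball 0 e" using e(2) by blast+
          then show "x \<in> cball 0 (1 / e)"
            using le e(1) by auto
        qed
        then have "bounded (- insert 0 (?N (- C)))" by (meson bounded_cball bounded_subset)
        moreover have c: "closed (- insert 0 (?N (- C)))" using o by (metis closed_Compl)
        ultimately have "compact (- insert 0 (?N (- C)))" by (simp add: compact_eq_bounded_closed)
        then show ?thesis unfolding eq'[OF False] openin_Alexandroff_compactification
          using c by (intro disjI2 exI[of _ "- insert 0 (?N (- C))"]) auto
      qed
    qed
  qed
  have ts: "topspace line_top = UNIV" by (auto simp: notin_range_Some)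
  show ?thesis unfolding continuous_map_def ts using opn by simp
qed

lemma homeomorphic_map_fin_chart:
  "homeomorphic_map (subtopology line_top (fst fin_chart)) euclideanreal (snd fin_chart)"
proof -
  have "embedding_map euclideanreal line_top Some"
    by (rule embedding_map_Some)
  then have "homeomorphic_map euclideanreal (subtopology line_top (range Some)) Some"
    by (simp add: embedding_map_def)
  moreover have "range Some = - {infpt}" using notin_range_Some by blast
  ultimately obtain g where
    g: "homeomorphic_maps euclideanreal (subtopology line_top (- {infpt})) Some g"
    by (metis homeomorphic_map_maps)
  have ts: "topspace line_top = UNIV" by (auto simp: notin_range_Some)
  have "continuous_map (subtopology line_top (- {infpt})) euclideanreal the"
  proof (rule continuous_map_eq)
    show "continuous_map (subtopology line_top (- {infpt})) euclideanreal g"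
      using g by (simp add: homeomorphic_maps_def)
    show "g p = the p" if "p \<in> topspace (subtopology line_top (- {infpt}))" for p
      using g that unfolding homeomorphic_maps_def ts by (cases p) auto
  qed
  then have "homeomorphic_maps euclideanreal (subtopology line_top (- {infpt})) Some the"
    using g unfolding homeomorphic_maps_def by (auto simp: ts)
  then show ?thesis
    unfolding fin_chart_def fst_conv snd_conv homeomorphic_map_maps
    using homeomorphic_maps_sym by blast
qed

lemma homeomorphic_map_inf_chart:
  "homeomorphic_map (subtopology line_top (fst inf_chart)) euclideanreal (snd inf_chart)"
proof -
  have ts: "topspace line_top = UNIV" by (auto simp: notin_range_Some)
  have h: "homeomorphic_map line_top line_top inv_pt"
    using continuous_map_inv_pt
    unfolding homeomorphic_map_maps homeomorphic_maps_def by (intro exI[of _ inv_pt]) simp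
  have "homeomorphic_map (subtopology line_top (- {Some 0})) (subtopology line_top (- {infpt})) inv_pt"
  proof (rule homeomorphic_map_subtopologies[OF h])
    have "inv_pt ` (- {Some 0}) = - {infpt}"
    proof (intro subset_antisym subsetI)
      fix p assume "p \<in> - {infpt}"
      then have "inv_pt p \<in> - {Some 0}" by (cases p) auto
      then show "p \<in> inv_pt ` (- {Some 0})" using image_eqI[of p inv_pt "inv_pt p"] by simp
    next
      fix p assume "p \<in> inv_pt ` (- {Some 0})"
      then obtain q where "q \<noteq> Some 0" "p = inv_pt q" by auto
      then show "p \<in> - {infpt}" by (cases q) auto
    qed
    then show "inv_pt ` (topspace line_top \<inter> - {Some 0}) = topspace line_top \<inter> - {infpt}"
      unfolding ts Int_UNIV_left .
  qed
  from homeomorphic_map_compose[OF this homeomorphic_map_fin_chart[unfolded fin_chart_def fst_conv snd_conv]]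
  show ?thesis by (simp only: inf_chart_def fst_conv snd_conv)
qed

lemma Ck_on_cong:
  assumes "Ck_on k f S" "open S" "\<And>x. x \<in> S \<Longrightarrow> g x = f x"
  shows "Ck_on k g S"
  using assms
proof (induction k arbitrary: f g)
  case 0
  then show ?case using continuous_on_cong[of S S g f] by simp
next
  case (Suc k)
  have d: "(f has_derivative D) (at x) \<longleftrightarrow> (g has_derivative D) (at x)" if "x \<in> S" for x D
    using has_derivative_transform_within_open[OF _ \<open>open S\<close> that, of f D UNIV g]
      has_derivative_transform_within_open[OF _ \<open>open S\<close> that, of g D UNIV f]
      Suc.prems(3) by auto
  then have eq: "frechet_derivative g (at x) = frechet_derivative f (at x)" if "x \<in> S" for x
    using that by (simp add: frechet_derivative_def)
  have "Ck_on k (\<lambda>x. frechet_derivative g (at x) v) S" for v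
    by (rule Suc.IH[of "\<lambda>x. frechet_derivative f (at x) v"]) (use Suc.prems eq in auto)
  moreover have "\<forall>x\<in>S. g differentiable (at x)"
    using Suc.prems(1) by (simp add: differentiable_def d)
  ultimately show ?case by simp
qed

lemma smooth_on_transition: "smooth_on (\<lambda>x::real. 1 / x) (- {0})"
proof -
  have "Ck_on k (\<lambda>x::real. c * inverse x ^ n) (- {0})" for k n c
  proof (induction k arbitrary: n c)
    case 0
    show ?case by (auto intro!: continuous_intros)
  next
    case (Suc k)
    have D: "((\<lambda>x::real. c * inverse x ^ n) has_derivative (\<lambda>v. - real n * c * v * inverse x ^ Suc n)) (at x)"
      if "x \<noteq> 0" for x
    proof -
      have "((\<lambda>x::real. c * inverse x ^ n) has_real_derivative - real n * c * inverse x ^ Suc n) (at x)"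
      proof (cases n)
        case (Suc m)
        then show ?thesis
          by (intro DERIV_cong[OF DERIV_cmult[OF DERIV_power[OF DERIV_inverse[OF that]]]])
            (simp add: algebra_simps)
      qed simp
      then show ?thesis unfolding has_field_derivative_def
        by (rule has_derivative_eq_rhs) (simp add: fun_eq_iff)
    qed
    have "Ck_on k (\<lambda>x. frechet_derivative (\<lambda>x::real. c * inverse x ^ n) (at x) v) (- {0})" for v
      by (rule Ck_on_cong[OF Suc.IH[of "- real n * c * v" "Suc n"]])
        (auto simp: frechet_derivative_at[OF D, symmetric])
    then show ?case using D by (auto simp: differentiable_def)
  qed
  from this[of _ 1 1] show ?thesis by (simp add: smooth_on_def divide_inverse)
qed

definition line4_atlas ::
  "(proj_real \<times> proj_real \<times> proj_real \<times> proj_real, real \<times> real \<times> real \<times> real) chart set" where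
  "line4_atlas = prod_atlas line_atlas (prod_atlas line_atlas (prod_atlas line_atlas line_atlas))"

definition diffeomorphic_to_circle :: "(proj_real \<times> proj_real \<times> proj_real \<times> proj_real) set \<Rightarrow> bool" where
  "diffeomorphic_to_circle A \<longleftrightarrow>
     diffeomorphic_subsets line4_atlas A euclidean_atlas (sphere (0::complex) 1)"

end

(* Equal bars: dividing the closing condition by the bar length says that four unit vectors add up to
   zero, 1 + a + ab + abc = 0 with a, b, c the exponentials of the turning angles at y, z, w. Two of
   four such vectors are always opposite, and so are the remaining two; the three ways of pairing
   them up are the three branches. Each branch is the image of the projective line under an embedding
   with components id, x \<mapsto> -x, x \<mapsto> 1/x or the constant \<infinity>, and the projective line is
   diffeomorphic to the circle by stereographic projection. *)

theory Submission
  imports Defs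
begin

section \<open>Calculus of smooth maps\<close>

lemma Ck_on_SucI:
  assumes "open S" "\<And>x. x \<in> S \<Longrightarrow> (f has_derivative f' x) (at x)" "\<And>v. Ck_on k (\<lambda>x. f' x v) S"
  shows "Ck_on (Suc k) f S"
proof -
  \<comment> \<open>Derivatives are unique, so a derivative formula found by the differentiation
    rules may stand in for \<open>frechet_derivative\<close> on all of \<open>S\<close>. The
    inductions below rest on this.\<close>
  have "Ck_on k (\<lambda>x. frechet_derivative f (at x) v) S" for v
    by (rule Ck_on_cong[OF assms(3)[of v] assms(1)])
      (simp add: frechet_derivative_at[OF assms(2), symmetric])
  then show ?thesis using assms(2) by (auto simp: differentiable_def)
qed

lemma Ck_on_Suc_has_derivative:
  "Ck_on (Suc k) f S \<Longrightarrow> x \<in> S \<Longrightarrow> (f has_derivative frechet_derivative f (at x)) (at x)"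
  by (simp flip: frechet_derivative_works)

text \<open>Differentiability gives continuity in the base case; the step passes to directional
  derivatives. Product and quotient rules need this, since the undifferentiated functions reappear
  in their derivatives.\<close>

lemma Ck_on_Suc_imp: "Ck_on (Suc k) f S \<Longrightarrow> Ck_on k f S"
proof (induction k arbitrary: f)
  case 0
  then show ?case
    by (auto intro!: continuous_at_imp_continuous_on differentiable_imp_continuous_within)
next
  case (Suc k)
  then show ?case
    by (metis Ck_on.simps(2))
qed

lemma Ck_on_subset: "Ck_on k f S \<Longrightarrow> T \<subseteq> S \<Longrightarrow> Ck_on k f T"
  by (induction k arbitrary: f) (auto intro: continuous_on_subset)

lemma Ck_on_const: "open S \<Longrightarrow> Ck_on k (\<lambda>_. c) S"
  by (induction k arbitrary: c) (auto intro!: Ck_on_SucI derivative_eq_intros simp del: Ck_on.simps(2))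

lemma Ck_on_linear: "open S \<Longrightarrow> bounded_linear L \<Longrightarrow> Ck_on k L S"
  by (cases k) (auto intro!: Ck_on_SucI Ck_on_const bounded_linear_imp_has_derivative
      linear_continuous_on simp del: Ck_on.simps(2))

text \<open>The directional derivatives of \<open>L\<close> after \<open>f\<close> are
  \<open>L\<close> after those of \<open>f\<close>, so the induction closes on itself. Composition
  with linear maps, on either side, is the only chain rule for class C^k used here.\<close>

lemma Ck_on_linear_comp:
  assumes "open S" "bounded_linear L" "Ck_on k f S"
  shows "Ck_on k (\<lambda>x. L (f x)) S"
  using assms(3)
proof (induction k arbitrary: f)
  case 0
  then show ?case using bounded_linear.continuous_on[OF assms(2)] by simp
next
  case (Suc k)
  show ?case
    by (rule Ck_on_SucI[OF assms(1)
          bounded_linear.has_derivative[OF assms(2) Ck_on_Suc_has_derivative[OF Suc.prems]]])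
      (use Suc in auto)
qed

text \<open>The derivative in direction \<open>v\<close> is that of \<open>f\<close> at
  \<open>L x\<close> in the direction \<open>L v\<close>. This direction does not depend on
  \<open>x\<close>, so the result is again a function of lower class after \<open>L\<close>.\<close>

lemma Ck_on_comp_linear:
  assumes "open S" "bounded_linear L" "Ck_on k f S"
  shows "Ck_on k (\<lambda>x. f (L x)) (L -` S)"
  using assms(3)
proof (induction k arbitrary: f)
  case 0
  then show ?case using linear_continuous_on[OF assms(2)]
    by (auto intro: continuous_on_compose2)
next
  case (Suc k)
  have o: "open (L -` S)"
    using assms(1,2) by (simp add: open_vimage linear_continuous_on)
  have "((\<lambda>x. f (L x)) has_derivative (\<lambda>v. frechet_derivative f (at (L x)) (L v))) (at x)"
    if "x \<in> L -` S" for x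
    using that
    by (intro has_derivative_compose[OF bounded_linear_imp_has_derivative[OF assms(2)]]
        Ck_on_Suc_has_derivative[OF Suc.prems]) auto
  then show ?case
    by (rule Ck_on_SucI[OF o]) (use Suc in auto)
qed

lemma Ck_on_add:
  assumes "open S" "Ck_on k f S" "Ck_on k g S"
  shows "Ck_on k (\<lambda>x. f x + g x) S"
  using assms(2,3)
proof (induction k arbitrary: f g)
  case 0
  then show ?case by (auto intro: continuous_on_add)
next
  case (Suc k)
  show ?case
    by (rule Ck_on_SucI[OF assms(1) has_derivative_add[OF
            Ck_on_Suc_has_derivative[OF Suc.prems(1)] Ck_on_Suc_has_derivative[OF Suc.prems(2)]]])
      (use Suc in auto)
qed

lemma Ck_on_mult:
  fixes f g :: "'a::euclidean_space \<Rightarrow> real"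
  assumes "open S" "Ck_on k f S" "Ck_on k g S"
  shows "Ck_on k (\<lambda>x. f x * g x) S"
  using assms(2,3)
proof (induction k arbitrary: f g)
  case 0
  then show ?case by (auto intro: continuous_on_mult)
next
  case (Suc k)
  have D: "Ck_on k (\<lambda>x. f x * frechet_derivative g (at x) v + frechet_derivative f (at x) v * g x) S"
    for v
    using Suc.prems
    by (intro Ck_on_add[OF assms(1)] Suc.IH Ck_on_Suc_imp[of k f] Ck_on_Suc_imp[of k g]) auto
  show ?case
    by (rule Ck_on_SucI[OF assms(1) has_derivative_mult[OF
            Ck_on_Suc_has_derivative[OF Suc.prems(1)] Ck_on_Suc_has_derivative[OF Suc.prems(2)]]])
      (assumption | rule D)+
qed

text \<open>The derivative contains the inverse of the same \<open>f\<close>. The induction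
  therefore keeps \<open>f\<close> fixed, and its hypothesis covers exactly that factor.\<close>

lemma Ck_on_inverse:
  fixes f :: "'a::euclidean_space \<Rightarrow> real"
  assumes "open S" "Ck_on k f S" "\<And>x. x \<in> S \<Longrightarrow> f x \<noteq> 0"
  shows "Ck_on k (\<lambda>x. inverse (f x)) S"
  using assms(2)
proof (induction k)
  case 0
  then show ?case using assms(3) by (auto intro: continuous_on_inverse)
next
  case (Suc k)
  have inv: "Ck_on k (\<lambda>x. inverse (f x)) S"
    using Suc Ck_on_Suc_imp by blast
  have D: "Ck_on k (\<lambda>x. - (inverse (f x) * frechet_derivative f (at x) v * inverse (f x))) S" for v
    using Suc.prems
    by (intro Ck_on_linear_comp[OF assms(1) bounded_linear_minus[OF bounded_linear_ident]]
        Ck_on_mult[OF assms(1)] inv) auto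
  show ?case
    by (rule Ck_on_SucI[OF assms(1)
          Deriv.has_derivative_inverse[OF assms(3) Ck_on_Suc_has_derivative[OF Suc.prems]]])
      (assumption | rule D)+
qed

section \<open>Infinitely differentiable functions\<close>

lemma smooth_on_subset: "smooth_on f S \<Longrightarrow> T \<subseteq> S \<Longrightarrow> smooth_on f T"
  by (auto simp: smooth_on_def intro: Ck_on_subset)

lemma smooth_on_const: "open S \<Longrightarrow> smooth_on (\<lambda>_. c) S"
  by (simp add: smooth_on_def Ck_on_const)

lemma smooth_on_linear: "open S \<Longrightarrow> bounded_linear L \<Longrightarrow> smooth_on L S"
  by (simp add: smooth_on_def Ck_on_linear)

lemma smooth_on_linear_comp:
  "open S \<Longrightarrow> bounded_linear L \<Longrightarrow> smooth_on f S \<Longrightarrow> smooth_on (\<lambda>x. L (f x)) S"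
  by (simp add: smooth_on_def Ck_on_linear_comp)

lemma smooth_on_comp_linear:
  "open S \<Longrightarrow> bounded_linear L \<Longrightarrow> smooth_on f S \<Longrightarrow> smooth_on (\<lambda>x. f (L x)) (L -` S)"
  by (simp add: smooth_on_def Ck_on_comp_linear)

lemma smooth_on_add:
  "open S \<Longrightarrow> smooth_on f S \<Longrightarrow> smooth_on g S \<Longrightarrow> smooth_on (\<lambda>x. f x + g x) S"
  by (simp add: smooth_on_def Ck_on_add)

lemma smooth_on_minus: "open S \<Longrightarrow> smooth_on f S \<Longrightarrow> smooth_on (\<lambda>x. - f x) S"
  using smooth_on_linear_comp[OF _ bounded_linear_minus[OF bounded_linear_ident]] by blast

lemma smooth_on_diff:
  "open S \<Longrightarrow> smooth_on f S \<Longrightarrow> smooth_on g S \<Longrightarrow> smooth_on (\<lambda>x. f x - g x) S"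
  using smooth_on_add[of S f "\<lambda>x. - g x"] by (simp add: smooth_on_minus)

lemma smooth_on_mult:
  fixes f g :: "'a::euclidean_space \<Rightarrow> real"
  shows "open S \<Longrightarrow> smooth_on f S \<Longrightarrow> smooth_on g S \<Longrightarrow> smooth_on (\<lambda>x. f x * g x) S"
  by (simp add: smooth_on_def Ck_on_mult)

lemma smooth_on_divide:
  fixes f g :: "'a::euclidean_space \<Rightarrow> real"
  assumes "open S" "smooth_on f S" "smooth_on g S" "\<And>x. x \<in> S \<Longrightarrow> g x \<noteq> 0"
  shows "smooth_on (\<lambda>x. f x / g x) S"
  using assms by (auto simp: smooth_on_def divide_inverse intro!: Ck_on_mult Ck_on_inverse)

lemma smooth_on_Pair:
  assumes "open S" "smooth_on f S" "smooth_on g S"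
  shows "smooth_on (\<lambda>x. (f x, g x)) S"
proof -
  have "bounded_linear (\<lambda>a::'b. (a, 0::'c))" "bounded_linear (\<lambda>b::'c. (0::'b, b))"
    by (intro bounded_linear_Pair bounded_linear_ident bounded_linear_zero)+
  \<comment> \<open>A pair is the sum of its images under the two linear inclusions, so sums and
    linear composition suffice.\<close>
  then have "smooth_on (\<lambda>x. (f x, 0) + (0, g x)) S"
    using assms by (intro smooth_on_add smooth_on_linear_comp[of S "\<lambda>a. (a, 0)"]
        smooth_on_linear_comp[of S "\<lambda>b. (0, b)"])
  then show ?thesis by simp
qed

lemma smooth_on_Complex:
  assumes "open S" "smooth_on f S" "smooth_on g S"
  shows "smooth_on (\<lambda>x. Complex (f x) (g x)) S"
proof -
  have "smooth_on (\<lambda>x. f x *\<^sub>R 1 + g x *\<^sub>R \<i>) S"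
    using assms by (intro smooth_on_add smooth_on_linear_comp[of S "\<lambda>a. a *\<^sub>R 1"]
        smooth_on_linear_comp[of S "\<lambda>a. a *\<^sub>R \<i>"] bounded_linear_scaleR_left)
  then show ?thesis by (simp add: complex_eq_iff Complex_eq scaleR_conv_of_real mult.commute)
qed

section \<open>Smooth maps between manifolds: pairs and coordinate projections\<close>

lemma smooth_map_on_euclidean_Pair:
  assumes "smooth_map_on euclidean_atlas \<B> A f" "smooth_map_on euclidean_atlas \<C> A g"
  shows "smooth_map_on euclidean_atlas (prod_atlas \<B> \<C>) A (\<lambda>p. (f p, g p))"
  unfolding smooth_map_on_def
proof
  fix p assume "p \<in> A"
  with assms obtain V \<psi> W F V' \<psi>' W' F' where
    1: "(V, \<psi>) \<in> \<B>" "f p \<in> V" "open W" "p \<in> W" "smooth_on F W"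
      "\<forall>q\<in>A. q \<in> W \<longrightarrow> f q \<in> V \<and> \<psi> (f q) = F q" and
    2: "(V', \<psi>') \<in> \<C>" "g p \<in> V'" "open W'" "p \<in> W'" "smooth_on F' W'"
      "\<forall>q\<in>A. q \<in> W' \<longrightarrow> g q \<in> V' \<and> \<psi>' (g q) = F' q"
    unfolding smooth_map_on_def euclidean_atlas_def by auto metis
  \<comment> \<open>The source has the single chart \<open>id\<close>, so both local representatives
    live on the same space and can be paired on the intersection of their domains without a change
    of chart.\<close>
  have s: "smooth_on (\<lambda>x. (F x, F' x)) (W \<inter> W')"
    using 1 2 by (intro smooth_on_Pair) (auto intro: smooth_on_subset)
  show "\<exists>U \<phi> X \<theta> W F. (U, \<phi>) \<in> euclidean_atlas \<and> p \<in> U \<and> (X, \<theta>) \<in> prod_atlas \<B> \<C> \<and>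
      (f p, g p) \<in> X \<and> open W \<and> \<phi> p \<in> W \<and> smooth_on F W \<and>
      (\<forall>q\<in>A \<inter> U. \<phi> q \<in> W \<longrightarrow> (f q, g q) \<in> X \<and> \<theta> (f q, g q) = F (\<phi> q))"
    by (rule exI[of _ UNIV], rule exI[of _ id], rule exI[of _ "V \<times> V'"],
        rule exI[of _ "map_prod \<psi> \<psi>'"], rule exI[of _ "W \<inter> W'"], rule exI[of _ "\<lambda>x. (F x, F' x)"])
      (use 1 2 s in \<open>auto simp: euclidean_atlas_def prod_atlas_def\<close>)
qed

text \<open>The local representative is that of \<open>f\<close> after the linear projection
  \<open>fst\<close>, on the cylinder over its domain. The covering assumption supplies some chart
  around the second component, whose coordinate is then ignored.\<close>

lemma smooth_map_on_comp_fst: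
  assumes f: "smooth_map_on \<B> \<C> B f" and A: "fst ` A \<subseteq> B" and cov: "\<Union>(fst ` \<A>) = UNIV"
  shows "smooth_map_on (prod_atlas \<B> \<A>) \<C> A (\<lambda>p. f (fst p))"
  unfolding smooth_map_on_def
proof
  fix p assume p: "p \<in> A"
  obtain U' \<phi>' where U': "(U', \<phi>') \<in> \<A>" "snd p \<in> U'" using UNIV_I[of "snd p", folded cov] by auto
  from p A have "fst p \<in> B" by blast
  from bspec[OF f[unfolded smooth_map_on_def] this] obtain U \<phi> V \<psi> W F where
    1: "(U, \<phi>) \<in> \<B>" "fst p \<in> U" "(V, \<psi>) \<in> \<C>" "f (fst p) \<in> V" "open W" "\<phi> (fst p) \<in> W"
      "smooth_on F W" "\<forall>q\<in>B \<inter> U. \<phi> q \<in> W \<longrightarrow> f q \<in> V \<and> \<psi> (f q) = F (\<phi> q)"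
    by metis
  have s: "smooth_on (\<lambda>x. F (fst x)) (fst -` W)" "open (fst -` W)"
    using 1 by (auto intro!: smooth_on_comp_linear bounded_linear_fst open_vimage_fst)
  show "\<exists>X \<theta> V \<psi> W F. (X, \<theta>) \<in> prod_atlas \<B> \<A> \<and> p \<in> X \<and> (V, \<psi>) \<in> \<C> \<and> f (fst p) \<in> V \<and>
      open W \<and> \<theta> p \<in> W \<and> smooth_on F W \<and>
      (\<forall>q\<in>A \<inter> X. \<theta> q \<in> W \<longrightarrow> f (fst q) \<in> V \<and> \<psi> (f (fst q)) = F (\<theta> q))"
    by (rule exI[of _ "U \<times> U'"], rule exI[of _ "map_prod \<phi> \<phi>'"], rule exI[of _ V], rule exI[of _ \<psi>],
        rule exI[of _ "fst -` W"], rule exI[of _ "\<lambda>x. F (fst x)"])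
      (use 1 s U' A in \<open>auto simp: prod_atlas_def image_subset_iff mem_Times_iff\<close>)
qed

lemma smooth_map_on_comp_snd:
  assumes f: "smooth_map_on \<B> \<C> B f" and A: "snd ` A \<subseteq> B" and cov: "\<Union>(fst ` \<A>) = UNIV"
  shows "smooth_map_on (prod_atlas \<A> \<B>) \<C> A (\<lambda>p. f (snd p))"
  unfolding smooth_map_on_def
proof
  fix p assume p: "p \<in> A"
  obtain U' \<phi>' where U': "(U', \<phi>') \<in> \<A>" "fst p \<in> U'" using UNIV_I[of "fst p", folded cov] by auto
  from p A have "snd p \<in> B" by blast
  from bspec[OF f[unfolded smooth_map_on_def] this] obtain U \<phi> V \<psi> W F where
    1: "(U, \<phi>) \<in> \<B>" "snd p \<in> U" "(V, \<psi>) \<in> \<C>" "f (snd p) \<in> V" "open W" "\<phi> (snd p) \<in> W"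
      "smooth_on F W" "\<forall>q\<in>B \<inter> U. \<phi> q \<in> W \<longrightarrow> f q \<in> V \<and> \<psi> (f q) = F (\<phi> q)"
    by metis
  have s: "smooth_on (\<lambda>x. F (snd x)) (snd -` W)" "open (snd -` W)"
    using 1 by (auto intro!: smooth_on_comp_linear bounded_linear_snd open_vimage_snd)
  show "\<exists>X \<theta> V \<psi> W F. (X, \<theta>) \<in> prod_atlas \<A> \<B> \<and> p \<in> X \<and> (V, \<psi>) \<in> \<C> \<and> f (snd p) \<in> V \<and>
      open W \<and> \<theta> p \<in> W \<and> smooth_on F W \<and>
      (\<forall>q\<in>A \<inter> X. \<theta> q \<in> W \<longrightarrow> f (snd q) \<in> V \<and> \<psi> (f (snd q)) = F (\<theta> q))"
    by (rule exI[of _ "U' \<times> U"], rule exI[of _ "map_prod \<phi>' \<phi>"], rule exI[of _ V], rule exI[of _ \<psi>],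
        rule exI[of _ "snd -` W"], rule exI[of _ "\<lambda>x. F (snd x)"])
      (use 1 s U' A in \<open>auto simp: prod_atlas_def image_subset_iff mem_Times_iff\<close>)
qed


section \<open>The projective line and the circle\<close>

lemma prod_atlas_covers:
  assumes "\<Union>(fst ` \<A>) = UNIV" "\<Union>(fst ` \<B>) = UNIV"
  shows "\<Union>(fst ` prod_atlas \<A> \<B>) = UNIV"
proof -
  have "(p, q) \<in> \<Union>(fst ` prod_atlas \<A> \<B>)" for p q
  proof -
    obtain U \<phi> V \<psi> where "(U, \<phi>) \<in> \<A>" "p \<in> U" "(V, \<psi>) \<in> \<B>" "q \<in> V"
      using UNIV_I[of p, folded assms(1)] UNIV_I[of q, folded assms(2)] by auto
    then have "(U \<times> V, map_prod \<phi> \<psi>) \<in> prod_atlas \<A> \<B>" "(p, q) \<in> U \<times> V"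
      unfolding prod_atlas_def by auto
    then show ?thesis by force
  qed
  then show ?thesis by auto
qed

lemma line_atlas_covers: "\<Union>(fst ` line_atlas) = UNIV"
  by (auto simp: line_atlas_def fin_chart_def inf_chart_def)

section \<open>Inversion, negation and the point at infinity\<close>

lemma inv_pt_eq_iff [simp]: "inv_pt p = None \<longleftrightarrow> p = Some 0" "inv_pt p = Some 0 \<longleftrightarrow> p = None"
  by (cases p; auto)+

lemma smooth_map_on_inv_pt:
  assumes "smooth_map_on \<A> line_atlas A f"
  shows "smooth_map_on \<A> line_atlas A (\<lambda>p. inv_pt (f p))"
  unfolding smooth_map_on_def
proof
  fix p assume "p \<in> A"
  with assms obtain U \<phi> V \<psi> W F where
    1: "(U, \<phi>) \<in> \<A>" "p \<in> U" "(V, \<psi>) \<in> line_atlas" "f p \<in> V" "open W" "\<phi> p \<in> W" "smooth_on F W"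
      "\<forall>q\<in>A \<inter> U. \<phi> q \<in> W \<longrightarrow> f q \<in> V \<and> \<psi> (f q) = F (\<phi> q)"
    unfolding smooth_map_on_def by metis
  \<comment> \<open>Inversion exchanges the two affine charts and keeps the coordinate, so the
    representative \<open>F\<close> serves unchanged once the target chart is swapped.\<close>
  have "\<exists>V' \<psi>'. (V', \<psi>') \<in> line_atlas \<and> (\<forall>r\<in>V. inv_pt r \<in> V' \<and> \<psi>' (inv_pt r) = \<psi> r)"
  proof (cases "(V, \<psi>) = fin_chart")
    case True
    then show ?thesis
      by (intro exI[of _ "fst inf_chart"] exI[of _ "snd inf_chart"])
        (auto simp: line_atlas_def fin_chart_def inf_chart_def)
  next
    case False
    then have "(V, \<psi>) = inf_chart" using 1(3) by (simp add: line_atlas_def)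
    then show ?thesis
      by (intro exI[of _ "fst fin_chart"] exI[of _ "snd fin_chart"])
        (auto simp: line_atlas_def fin_chart_def inf_chart_def)
  qed
  then obtain V' \<psi>' where "(V', \<psi>') \<in> line_atlas" "\<forall>r\<in>V. inv_pt r \<in> V' \<and> \<psi>' (inv_pt r) = \<psi> r"
    by blast
  with 1 show "\<exists>U \<phi> V \<psi> W F. (U, \<phi>) \<in> \<A> \<and> p \<in> U \<and> (V, \<psi>) \<in> line_atlas \<and> inv_pt (f p) \<in> V \<and>
      open W \<and> \<phi> p \<in> W \<and> smooth_on F W \<and>
      (\<forall>q\<in>A \<inter> U. \<phi> q \<in> W \<longrightarrow> inv_pt (f q) \<in> V \<and> \<psi> (inv_pt (f q)) = F (\<phi> q))"
    by (intro exI[of _ U] exI[of _ \<phi>] exI[of _ V'] exI[of _ \<psi>'] exI[of _ W] exI[of _ F]) auto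
qed

lemma smooth_map_on_neg_pt:
  assumes "smooth_map_on \<A> line_atlas A f"
  shows "smooth_map_on \<A> line_atlas A (\<lambda>p. neg_pt (f p))"
  unfolding smooth_map_on_def
proof
  fix p assume "p \<in> A"
  with assms obtain U \<phi> V \<psi> W F where
    1: "(U, \<phi>) \<in> \<A>" "p \<in> U" "(V, \<psi>) \<in> line_atlas" "f p \<in> V" "open W" "\<phi> p \<in> W" "smooth_on F W"
      "\<forall>q\<in>A \<inter> U. \<phi> q \<in> W \<longrightarrow> f q \<in> V \<and> \<psi> (f q) = F (\<phi> q)"
    unfolding smooth_map_on_def by metis
  \<comment> \<open>Negation preserves both chart domains and negates both coordinates; in the chart
    \<open>1/x\<close> the point at infinity has coordinate 0, in agreement with its being
    fixed.\<close>
  have "neg_pt r \<in> V \<and> \<psi> (neg_pt r) = - \<psi> r" if "r \<in> V" for r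
    using 1(3) that by (cases r) (auto simp: line_atlas_def fin_chart_def inf_chart_def)
  moreover have "smooth_on (\<lambda>x. - F x) W"
    using 1 by (simp add: smooth_on_minus)
  ultimately show "\<exists>U \<phi> V \<psi> W F. (U, \<phi>) \<in> \<A> \<and> p \<in> U \<and> (V, \<psi>) \<in> line_atlas \<and> neg_pt (f p) \<in> V \<and>
      open W \<and> \<phi> p \<in> W \<and> smooth_on F W \<and>
      (\<forall>q\<in>A \<inter> U. \<phi> q \<in> W \<longrightarrow> neg_pt (f q) \<in> V \<and> \<psi> (neg_pt (f q)) = F (\<phi> q))"
    using 1
    by (intro exI[of _ U] exI[of _ \<phi>] exI[of _ V] exI[of _ \<psi>] exI[of _ W] exI[of _ "\<lambda>x. - F x"]) auto
qed

lemma smooth_map_on_infpt: "smooth_map_on euclidean_atlas line_atlas A (\<lambda>_. infpt)"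
  unfolding smooth_map_on_def euclidean_atlas_def
  by (intro ballI exI[of _ UNIV] exI[of _ id] exI[of _ "fst inf_chart"] exI[of _ "snd inf_chart"]
      exI[of _ "\<lambda>_. 0"])
    (auto simp: line_atlas_def inf_chart_def smooth_on_const)

section \<open>Stereographic projection of the unit circle from -1\<close>

fun circle_of_line :: "proj_real \<Rightarrow> complex" where
  "circle_of_line None = - 1"
| "circle_of_line (Some x) = Complex ((1 - x * x) / (1 + x * x)) (2 * x / (1 + x * x))"

text \<open>The slope of the line through -1 and \<open>q\<close>. For \<open>q = cis t\<close> it
  is the tangent of \<open>t / 2\<close>, and \<open>circle_of_line\<close> recovers the cosine and
  sine of \<open>t\<close> by the half-angle formulas.\<close>

definition line_of_circle :: "complex \<Rightarrow> proj_real" where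
  "line_of_circle q = (if Re q = - 1 then infpt else Some (Im q / (1 + Re q)))"

lemma one_plus_square_neq_0: "1 + x * x \<noteq> (0::real)"
  using zero_le_square[of x] by linarith

lemma circle_of_line_in_sphere: "circle_of_line p \<in> sphere 0 1"
proof (cases p)
  case (Some x)
  have "(1 - x * x)\<^sup>2 + (2 * x)\<^sup>2 = (1 + x * x)\<^sup>2" by algebra
  then have "((1 - x * x) / (1 + x * x))\<^sup>2 + (2 * x / (1 + x * x))\<^sup>2 = 1"
    using one_plus_square_neq_0[of x]
    by (simp add: power_divide flip: add_divide_distrib)
  then show ?thesis using Some by (simp add: cmod_def)
qed simp

text \<open>The factored circle equation is the form in which \<open>1 + Re q\<close> can be
  cancelled, and in which the slope can be exchanged for its reciprocal.\<close>

lemma sphere_eq: "q \<in> sphere (0::complex) 1 \<longleftrightarrow> Im q * Im q = (1 - Re q) * (1 + Re q)"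
  by (auto simp: cmod_def algebra_simps power2_eq_square)

lemma line_of_circle_of_line: "line_of_circle (circle_of_line p) = p"
proof (cases p)
  case (Some x)
  have s: "1 + (1 - x * x) / (1 + x * x) = 2 / (1 + x * x)"
    using one_plus_square_neq_0[of x] by (simp add: field_simps)
  then have "(1 - x * x) / (1 + x * x) \<noteq> - 1"
    using one_plus_square_neq_0[of x] by auto
  then show ?thesis using Some s one_plus_square_neq_0[of x] by (simp add: line_of_circle_def)
qed (simp add: line_of_circle_def)

lemma circle_of_line_of_circle:
  assumes "q \<in> sphere 0 1" shows "circle_of_line (line_of_circle q) = q"
proof (cases "Re q = - 1")
  case True
  then show ?thesis using assms unfolding sphere_eq
    by (simp add: line_of_circle_def complex_eq_iff)
next
  case False
  then have n: "1 + Re q \<noteq> 0" by linarith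
  define t where "t = Im q / (1 + Re q)"
  have im: "Im q = t * (1 + Re q)" using n by (simp add: t_def)
  \<comment> \<open>This is the circle equation at the second intersection with the line of slope
    \<open>t\<close> through -1, with the root \<open>Re q = - 1\<close> divided out; what remains
    is linear in \<open>Re q\<close>.\<close>
  have tt: "t * t * (1 + Re q) = 1 - Re q"
  proof -
    have "(t * t * (1 + Re q)) * (1 + Re q) = (1 - Re q) * (1 + Re q)"
      using assms unfolding sphere_eq im by (simp add: algebra_simps)
    then show ?thesis by (rule iffD1[OF mult_right_cancel[OF n]])
  qed
  then have s: "(1 + t * t) * (1 + Re q) = 2" by (simp add: algebra_simps)
  have "(1 - t * t) / (1 + t * t) = Re q"
    using tt one_plus_square_neq_0[of t] by (simp add: field_simps)
  moreover have "2 * t / (1 + t * t) = Im q"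
  proof -
    have "t * (1 + Re q) * (1 + t * t) = t * ((1 + t * t) * (1 + Re q))" by (simp only: ac_simps)
    then have "2 * t = t * (1 + Re q) * (1 + t * t)" unfolding s by simp
    then show ?thesis using one_plus_square_neq_0[of t] unfolding im
      by (simp add: nonzero_divide_eq_eq)
  qed
  ultimately show ?thesis using False by (simp add: line_of_circle_def t_def complex_eq_iff)
qed

lemma smooth_map_on_circle_of_line: "smooth_map_on line_atlas euclidean_atlas A circle_of_line"
  unfolding smooth_map_on_def
proof
  fix p assume "p \<in> A"
  \<comment> \<open>Replacing \<open>x\<close> by \<open>1/x\<close> only flips the sign of the real
    part. Hence \<open>c = 1\<close> gives the representative in the chart \<open>x\<close>, and
    \<open>c = - 1\<close> the one in the chart \<open>1/x\<close>.\<close>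
  have s: "smooth_on (\<lambda>x. Complex (c * ((1 - x * x) / (1 + x * x))) (2 * x / (1 + x * x))) UNIV"
    for c :: real
    using one_plus_square_neq_0
    by (intro smooth_on_Complex smooth_on_mult smooth_on_divide smooth_on_add smooth_on_diff
        smooth_on_const smooth_on_linear bounded_linear_ident) auto
  let ?G = "\<lambda>c x. Complex (c * ((1 - x * x) / (1 + x * x))) (2 * x / (1 + x * x))"
  have f: "circle_of_line r = ?G 1 (the r)" if "r \<noteq> None" for r
    using that by auto
  have i: "circle_of_line r = ?G (- 1) (the (inv_pt r))" if "r \<noteq> Some 0" for r
  proof (cases r)
    case (Some x)
    with that have x: "x \<noteq> 0" by simp
    have "1 + 1 / x * (1 / x) = (1 + x * x) / (x * x)" "1 - 1 / x * (1 / x) = - (1 - x * x) / (x * x)"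
      using x by (simp_all add: field_simps)
    then show ?thesis using Some x by simp
  qed (simp add: complex_eq_iff)
  show "\<exists>U \<phi> V \<psi> W F. (U, \<phi>) \<in> line_atlas \<and> p \<in> U \<and> (V, \<psi>) \<in> euclidean_atlas \<and>
      circle_of_line p \<in> V \<and> open W \<and> \<phi> p \<in> W \<and> smooth_on F W \<and>
      (\<forall>q\<in>A \<inter> U. \<phi> q \<in> W \<longrightarrow> circle_of_line q \<in> V \<and> \<psi> (circle_of_line q) = F (\<phi> q))"
  proof (cases p)
    case (Some x)
    show ?thesis
      by (rule exI[of _ "fst fin_chart"], rule exI[of _ "snd fin_chart"], rule exI[of _ UNIV],
          rule exI[of _ id], rule exI[of _ UNIV], rule exI[of _ "?G 1"])
        (use Some f s[of 1] in \<open>auto simp: line_atlas_def fin_chart_def euclidean_atlas_def\<close>)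
  next
    case None
    show ?thesis
      by (rule exI[of _ "fst inf_chart"], rule exI[of _ "snd inf_chart"], rule exI[of _ UNIV],
          rule exI[of _ id], rule exI[of _ UNIV], rule exI[of _ "?G (- 1)"])
        (use None i s[of "- 1"] in \<open>auto simp: line_atlas_def inf_chart_def euclidean_atlas_def\<close>)
  qed
qed

lemma smooth_map_on_line_of_circle:
  "smooth_map_on euclidean_atlas line_atlas (sphere 0 1) line_of_circle"
  unfolding smooth_map_on_def
proof
  fix p :: complex assume p: "p \<in> sphere 0 1"
  have o: "open {q. c + Re q \<noteq> 0}" "open {q. c - Re q \<noteq> 0}" for c :: real
    by (intro open_Collect_neq continuous_intros)+
  have s: "smooth_on (\<lambda>q. Im q / (1 + Re q)) {q. 1 + Re q \<noteq> 0}"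
    "smooth_on (\<lambda>q. Im q / (1 - Re q)) {q. 1 - Re q \<noteq> 0}"
    by (intro smooth_on_divide smooth_on_add smooth_on_diff smooth_on_const o
        smooth_on_linear[OF _ bounded_linear_Re] smooth_on_linear[OF _ bounded_linear_Im]; simp)+
  have f: "line_of_circle q \<noteq> None \<and> the (line_of_circle q) = Im q / (1 + Re q)"
    if "1 + Re q \<noteq> 0" for q
    using that by (auto simp: line_of_circle_def)
  \<comment> \<open>The reciprocal slope \<open>(1 + Re q) / Im q\<close> equals
    \<open>Im q / (1 - Re q)\<close> by the circle equation, and the latter is smooth near -1. The
    two agree only on the circle, hence the restriction to \<open>sphere 0 1\<close>.\<close>
  have i: "line_of_circle q \<noteq> Some 0 \<and> the (inv_pt (line_of_circle q)) = Im q / (1 - Re q)"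
    if "1 - Re q \<noteq> 0" "q \<in> sphere 0 1" for q
  proof (cases "Re q = - 1")
    case True
    then show ?thesis using that unfolding sphere_eq by (simp add: line_of_circle_def)
  next
    case False
    then have "1 + Re q \<noteq> 0" by linarith
    moreover from this have "Im q \<noteq> 0" using that unfolding sphere_eq by auto
    ultimately show ?thesis using that False unfolding sphere_eq
      by (simp add: line_of_circle_def field_simps)
  qed
  show "\<exists>U \<phi> V \<psi> W F. (U, \<phi>) \<in> euclidean_atlas \<and> p \<in> U \<and> (V, \<psi>) \<in> line_atlas \<and>
      line_of_circle p \<in> V \<and> open W \<and> \<phi> p \<in> W \<and> smooth_on F W \<and>
      (\<forall>q\<in>sphere 0 1 \<inter> U. \<phi> q \<in> W \<longrightarrow> line_of_circle q \<in> V \<and> \<psi> (line_of_circle q) = F (\<phi> q))"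
  proof (cases "1 + Re p = 0")
    case False
    show ?thesis
      by (rule exI[of _ UNIV], rule exI[of _ id], rule exI[of _ "fst fin_chart"],
          rule exI[of _ "snd fin_chart"], rule exI[of _ "{q. 1 + Re q \<noteq> 0}"],
          rule exI[of _ "\<lambda>q. Im q / (1 + Re q)"])
        (use False f s o[of 1] in \<open>auto simp: line_atlas_def fin_chart_def euclidean_atlas_def\<close>)
  next
    case True
    show ?thesis
      by (rule exI[of _ UNIV], rule exI[of _ id], rule exI[of _ "fst inf_chart"],
          rule exI[of _ "snd inf_chart"], rule exI[of _ "{q. 1 - Re q \<noteq> 0}"],
          rule exI[of _ "\<lambda>q. Im q / (1 - Re q)"])
        (use True p i s o[of 1] in \<open>auto simp: line_atlas_def inf_chart_def euclidean_atlas_def\<close>)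
  qed
qed

text \<open>Here \<open>h\<close> parametrises \<open>A\<close> by the projective line and
  \<open>pr\<close> reads the parameter back off a point. Composing both with stereographic
  projection gives mutually inverse maps, which leaves only smoothness to check.\<close>

lemma diffeomorphic_to_circleI:
  assumes A: "A = range h" and pr: "\<And>x. pr (h x) = x"
    and f: "smooth_map_on line4_atlas euclidean_atlas A (\<lambda>p. circle_of_line (pr p))"
    and g: "smooth_map_on euclidean_atlas line4_atlas (sphere 0 1) (\<lambda>q. h (line_of_circle q))"
  shows "diffeomorphic_to_circle A"
proof -
  let ?f = "\<lambda>p. circle_of_line (pr p)" and ?g = "\<lambda>q. h (line_of_circle q)"
  have 1: "\<forall>p\<in>A. ?g (?f p) = p" using A pr by (auto simp: line_of_circle_of_line)
  have 2: "\<forall>q\<in>sphere 0 1. ?f (?g q) = q" using pr by (auto simp: circle_of_line_of_circle)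
  have 3: "?f ` A \<subseteq> sphere 0 1" using circle_of_line_in_sphere by blast
  have 4: "?g ` sphere 0 1 \<subseteq> A" using A by auto
  have "?f ` A = sphere 0 1"
    using 2 3 4 by (metis (no_types, lifting) image_eqI image_subset_iff subsetI subset_antisym)
  moreover have "?g ` sphere 0 1 = A"
    using 1 3 4 by (metis (no_types, lifting) image_eqI image_subset_iff subsetI subset_antisym)
  ultimately show ?thesis
    unfolding diffeomorphic_to_circle_def diffeomorphic_subsets_def using f g 1 2 by blast
qed

lemma smooth_map_on_line4_fst:
  "smooth_map_on line4_atlas euclidean_atlas A (\<lambda>p. circle_of_line (fst p))"
  unfolding line4_atlas_def
  by (rule smooth_map_on_comp_fst[OF smooth_map_on_circle_of_line subset_UNIV])
    (intro prod_atlas_covers line_atlas_covers)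

lemma smooth_map_on_line4_snd:
  "smooth_map_on line4_atlas euclidean_atlas A (\<lambda>p. circle_of_line (fst (snd p)))"
  unfolding line4_atlas_def
  by (rule smooth_map_on_comp_snd[OF
        smooth_map_on_comp_fst[OF smooth_map_on_circle_of_line subset_UNIV] subset_UNIV])
    (intro prod_atlas_covers line_atlas_covers)+


section \<open>The rhombus\<close>

lemma rcong_pi_iff: "[\<rho> = pi] (rmod 2 * pi) \<longleftrightarrow> cos (\<rho> / 2) = 0"
proof -
  have "[\<rho> = pi] (rmod 2 * pi) \<longleftrightarrow> (\<exists>k. \<rho> = pi + of_int k * (2 * pi))"
    by (metis rcong_altdef rcong_sym)
  also have "\<dots> \<longleftrightarrow> (\<exists>k. \<rho> / 2 = of_int k * pi + pi / 2)"
    by (simp add: field_simps)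
  finally show ?thesis by (simp add: cos_zero_iff_int2)
qed

lemma half_tan_eq:
  "half_tan \<rho> = (if cos (\<rho> / 2) = 0 then infpt else Some (sin (\<rho> / 2) / cos (\<rho> / 2)))"
  by (simp add: half_tan_def rcong_pi_iff tan_def)

lemma half_tan_pi: "half_tan pi = infpt"
  by (simp add: half_tan_def)

lemma half_tan_minus: "half_tan (- \<rho>) = neg_pt (half_tan \<rho>)"
  by (simp add: half_tan_eq)

lemma half_tan_pi_minus: "half_tan (pi - \<rho>) = inv_pt (half_tan \<rho>)"
proof -
  have h: "(pi - \<rho>) / 2 = pi / 2 - \<rho> / 2" by (simp add: diff_divide_distrib)
  have "cos ((pi - \<rho>) / 2) = sin (\<rho> / 2)" "sin ((pi - \<rho>) / 2) = cos (\<rho> / 2)"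
    unfolding h cos_diff sin_diff by simp_all
  \<comment> \<open>Sine and cosine trade places, so the quotient is inverted. As they never vanish
    together, the degenerate cases are exactly 0 and infinity, which \<open>inv_pt\<close>
    exchanges.\<close>
  moreover have "\<not> (sin (\<rho> / 2) = 0 \<and> cos (\<rho> / 2) = 0)"
    by (metis sin_zero_abs_cos_one abs_zero zero_neq_one)
  ultimately show ?thesis by (auto simp: half_tan_eq)
qed

lemma half_tan_surj: obtains \<rho> where "half_tan \<rho> = p"
proof (cases p)
  case None
  then show ?thesis using half_tan_pi that by blast
next
  case (Some x)
  have "half_tan (2 * arctan x) = Some x"
    using cos_arctan_not_zero[of x] tan_arctan[of x] by (simp add: half_tan_eq tan_def)
  then show ?thesis using Some that by blast
qed

text \<open>Lets angles modulo \<open>2 * pi\<close> be handled as unit complex numbers, so that no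
  congruences need to be carried along.\<close>

lemma half_tan_cis_cong: "cis a = cis b \<Longrightarrow> half_tan a = half_tan b"
  by (rule half_tan_cong) (simp add: cis_eq_iff)

section \<open>The closing condition for equal bars\<close>

lemma rhombus_closing_iff:
  fixes a b c :: complex
  assumes "norm a = 1" "norm b = 1" "norm c = 1"
  shows "1 + a + a * b + a * b * c = 0 \<longleftrightarrow>
    (a * b = - 1 \<and> b * c = - 1) \<or> (a = - 1 \<and> c = - 1) \<or> (b = - 1 \<and> a * c = 1)"
proof -
  \<comment> \<open>One grouping for each way of splitting the four vectors into two pairs. Once the
    pair containing 1 cancels, the other pair must cancel too, because its factor in front is
    nonzero.\<close>
  have pairings: "1 + a + a * b + a * b * c = (1 + a * b) + a * (1 + b * c)"
    "1 + a + a * b + a * b * c = (1 + a) + a * b * (1 + c)"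
    "1 + a + a * b + a * b * c = (1 + a * b * c) + a * (1 + b)"
    by (simp_all add: algebra_simps)
  show ?thesis
  proof
    \<comment> \<open>The conjugate of a unit vector is its inverse, so conjugating the relation
      \<open>1 + u + v + w = 0\<close> gives \<open>uv + uw + vw + uvw = 0\<close>, which together with the relation itself
      yields \<open>(1 + u)(1 + v)(1 + w) = 0\<close>.\<close>
    assume r: "1 + a + a * b + a * b * c = 0"
    define u v w where "u = a" and "v = a * b" and "w = a * b * c"
    have norms: "norm u = 1" "norm v = 1" "norm w = 1"
      using assms by (simp_all add: u_def v_def w_def norm_mult)
    have unit: "cnj x * x = 1" if "norm x = 1" for x
      using complex_norm_square[of x] that by (simp add: mult.commute)
    have r': "1 + u + v + w = 0" using r by (simp add: u_def v_def w_def)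
    then have "cnj (1 + u + v + w) = 0" by simp
    then have "u * v * w * (1 + cnj u + cnj v + cnj w) = 0" by simp
    moreover have "u * v * w * (1 + cnj u + cnj v + cnj w) =
        u * v * w + cnj u * u * (v * w) + cnj v * v * (u * w) + cnj w * w * (u * v)"
      by (simp add: algebra_simps)
    ultimately have "u * v * w + v * w + u * w + u * v = 0"
      by (simp add: unit norms)
    moreover have "(1 + u) * (1 + v) * (1 + w) =
        (1 + u + v + w) + (u * v * w + v * w + u * w + u * v)"
      by (simp add: algebra_simps)
    ultimately have "(1 + a) * (1 + a * b) * (1 + a * b * c) = 0"
      using r' by (simp add: u_def v_def w_def)
    moreover have nz: "a \<noteq> 0" "b \<noteq> 0" "c \<noteq> 0" using assms by auto
    ultimately consider "a = - 1" | "a * b = - 1" | "a * b * c = - 1"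
      by (metis add_eq_0_iff mult_eq_0_iff)
    then show "(a * b = - 1 \<and> b * c = - 1) \<or> (a = - 1 \<and> c = - 1) \<or> (b = - 1 \<and> a * c = 1)"
    proof cases
      case 1
      then have "a * b * (1 + c) = 0" using r unfolding pairings(2) by simp
      then show ?thesis using 1 nz by (simp add: add_eq_0_iff)
    next
      case 2
      then have "a * (1 + b * c) = 0" using r unfolding pairings(1) by simp
      then show ?thesis using 2 nz by (simp add: add_eq_0_iff)
    next
      case 3
      then have "a * (1 + b) = 0" using r unfolding pairings(3) by simp
      then have "b = - 1" using nz by (simp add: add_eq_0_iff)
      \<comment> \<open>With \<open>b = - 1\<close>, the equation \<open>a * b * c = - 1\<close>
        becomes \<open>a * c = 1\<close>.\<close>
      then show ?thesis using 3 by simp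
    qed
  next
    assume "(a * b = - 1 \<and> b * c = - 1) \<or> (a = - 1 \<and> c = - 1) \<or> (b = - 1 \<and> a * c = 1)"
    then show "1 + a + a * b + a * b * c = 0"
    proof (elim disjE conjE)
      assume "a * b = - 1" "b * c = - 1"
      then show ?thesis unfolding pairings(1) by simp
    next
      assume "a = - 1" "c = - 1"
      then show ?thesis unfolding pairings(2) by simp
    next
      assume "b = - 1" "a * c = 1"
      then show ?thesis unfolding pairings(3) by simp
    qed
  qed
qed

text \<open>The angle sum becomes a product of unit complex numbers, and the positive common bar
  length cancels from the closing equation.\<close>

lemma is_configuration_angles_rhombus:
  assumes "\<alpha> > 0"
  shows "is_configuration_angles \<alpha> \<alpha> \<alpha> \<alpha> \<rho>x \<rho>y \<rho>z \<rho>w \<longleftrightarrow>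
    cis \<rho>x * cis \<rho>y * cis \<rho>z * cis \<rho>w = 1 \<and>
    ((cis \<rho>y * cis \<rho>z = - 1 \<and> cis \<rho>z * cis \<rho>w = - 1) \<or>
     (cis \<rho>y = - 1 \<and> cis \<rho>w = - 1) \<or> (cis \<rho>z = - 1 \<and> cis \<rho>y * cis \<rho>w = 1))"
proof -
  have "of_real \<alpha> + of_real \<alpha> * cis \<rho>y + of_real \<alpha> * cis (\<rho>y + \<rho>z)
      + of_real \<alpha> * cis (\<rho>y + \<rho>z + \<rho>w) = of_real \<alpha> *
      (1 + cis \<rho>y + cis \<rho>y * cis \<rho>z + cis \<rho>y * cis \<rho>z * cis \<rho>w)"
    by (simp add: cis_mult algebra_simps)
  then show ?thesis
    using assms rhombus_closing_iff[of "cis \<rho>y" "cis \<rho>z" "cis \<rho>w"]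
    by (simp add: is_configuration_angles_def cis_mult flip: cis_eq_iff)
qed

section \<open>The three branches\<close>

lemma configurations_rhombus:
  assumes "\<alpha> > 0"
  shows "configurations \<alpha> \<alpha> \<alpha> \<alpha> =
    {(x, inv_pt x, x, inv_pt x) | x. True} \<union>
    {(x, infpt, neg_pt x, infpt) | x. True} \<union>
    {(infpt, y, infpt, neg_pt y) | y. True}" (is "_ = ?R")
proof (intro subset_antisym subsetI)
  fix t assume "t \<in> configurations \<alpha> \<alpha> \<alpha> \<alpha>"
  then obtain X Y Z W where t: "t = (half_tan X, half_tan Y, half_tan Z, half_tan W)"
    and p: "cis X * cis Y * cis Z * cis W = 1"
    and c: "(cis Y * cis Z = - 1 \<and> cis Z * cis W = - 1) \<or> (cis Y = - 1 \<and> cis W = - 1) \<or>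
      (cis Z = - 1 \<and> cis Y * cis W = 1)"
    by (auto simp: configurations_def is_configuration_angles_rhombus[OF assms])
  \<comment> \<open>Product -1 means that the angles add up to \<open>pi\<close> modulo
    \<open>2 * pi\<close>, which makes the coordinates reciprocal; product 1, treated next, makes
    them negatives of each other.\<close>
  have opp: "half_tan a = half_tan (pi - b)" if "cis a * cis b = - 1" for a b
  proof (rule half_tan_cis_cong)
    have "cis a * cis b = cis (pi - b) * cis b" using that by (simp add: cis_mult)
    then show "cis a = cis (pi - b)" by simp
  qed
  have neg: "half_tan a = half_tan (- b)" if "cis a * cis b = 1" for a b
  proof (rule half_tan_cis_cong)
    have "cis a * cis b = cis (- b) * cis b" using that by (simp add: cis_mult)
    then show "cis a = cis (- b)" by simp
  qed
  have inf: "half_tan a = infpt" if "cis a = - 1" for a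
    using that half_tan_cis_cong[of a pi] by (simp add: half_tan_pi)
  from c consider "cis Y * cis Z = - 1" "cis Z * cis W = - 1" | "cis Y = - 1" "cis W = - 1" |
    "cis Z = - 1" "cis Y * cis W = 1" by blast
  then show "t \<in> ?R"
  proof cases
    case 1
    \<comment> \<open>The angle \<open>X\<close> is absent from the closing condition; here and in
      the other cases it is recovered from the angle sum.\<close>
    have "cis X * cis W * (cis Y * cis Z) = 1" using p by (simp only: ac_simps)
    then have "cis X * cis W = - 1" unfolding 1 by (simp add: minus_equation_iff)
    then have "half_tan X = half_tan (pi - W)" by (rule opp)
    also have "\<dots> = half_tan Z" using 1 opp[of Z W] by simp
    finally have "half_tan X = half_tan Z" .
    moreover have "half_tan W = half_tan (pi - Z)" using 1 opp[of W Z] by (simp add: mult.commute)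
    moreover have "half_tan Y = half_tan (pi - Z)" using 1 opp by blast
    ultimately show ?thesis unfolding t by (auto simp: half_tan_pi_minus)
  next
    case 2
    then have "cis Z * cis X = 1" using p by (simp add: mult.commute)
    then show ?thesis using neg[of Z X] inf 2 unfolding t by (auto simp: half_tan_minus)
  next
    case 3
    have "cis X * cis Z * (cis Y * cis W) = 1" using p by (simp only: ac_simps)
    then have "cis X = - 1" unfolding 3 by (simp add: minus_equation_iff)
    moreover have "cis W * cis Y = 1" using 3 by (simp add: mult.commute)
    ultimately show ?thesis using neg[of W Y] inf 3 unfolding t by (auto simp: half_tan_minus)
  qed
next
  fix t assume "t \<in> ?R"
  have I: "(half_tan X, half_tan Y, half_tan Z, half_tan W) \<in> configurations \<alpha> \<alpha> \<alpha> \<alpha>"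
    if "is_configuration_angles \<alpha> \<alpha> \<alpha> \<alpha> X Y Z W" for X Y Z W
    unfolding configurations_def mem_Collect_eq
    by (rule exI[of _ X], rule exI[of _ Y], rule exI[of _ Z], rule exI[of _ W]) (use that in simp)
  from \<open>t \<in> ?R\<close> consider x where "t = (x, inv_pt x, x, inv_pt x)"
    | x where "t = (x, infpt, neg_pt x, infpt)" | y where "t = (infpt, y, infpt, neg_pt y)" by blast
  then show "t \<in> configurations \<alpha> \<alpha> \<alpha> \<alpha>"
  proof cases
    case (1 x)
    obtain \<rho> where \<rho>: "half_tan \<rho> = x" by (rule half_tan_surj)
    \<comment> \<open>Turning angles of a genuine rhombus, with opposite bars antiparallel when
      traversed.\<close>
    have "is_configuration_angles \<alpha> \<alpha> \<alpha> \<alpha> \<rho> (pi - \<rho>) \<rho> (pi - \<rho>)"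
      by (simp add: is_configuration_angles_rhombus[OF assms] cis_mult)
    from I[OF this] show ?thesis by (simp add: 1 \<rho> half_tan_pi_minus)
  next
    case (2 x)
    obtain \<rho> where \<rho>: "half_tan \<rho> = x" by (rule half_tan_surj)
    \<comment> \<open>The bars are folded over at \<open>y\<close> and \<open>w\<close>, so \<gamma>
      lies on \<beta> and \<alpha> on \<delta>; the angle between the two doubled bars is free. In
      the last case the folds are at \<open>x\<close> and \<open>z\<close>.\<close>
    have "is_configuration_angles \<alpha> \<alpha> \<alpha> \<alpha> \<rho> pi (- \<rho>) pi"
      by (simp add: is_configuration_angles_rhombus[OF assms] cis_mult)
    from I[OF this] show ?thesis by (simp add: 2 \<rho> half_tan_minus half_tan_pi)
  next
    case (3 y)
    obtain \<rho> where \<rho>: "half_tan \<rho> = y" by (rule half_tan_surj)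
    have "is_configuration_angles \<alpha> \<alpha> \<alpha> \<alpha> pi \<rho> pi (- \<rho>)"
      by (simp add: is_configuration_angles_rhombus[OF assms] cis_mult)
    from I[OF this] show ?thesis by (simp add: 3 \<rho> half_tan_minus half_tan_pi)
  qed
qed

theorem mainTheorem2:
  fixes \<alpha> \<beta> \<gamma> \<delta> :: real
  assumes "\<alpha> > 0" and "\<alpha> = \<beta>" and "\<beta> = \<gamma>" and "\<gamma> = \<delta>"
  shows "configurations \<alpha> \<beta> \<gamma> \<delta> =
           {(x, inv_pt x, x, inv_pt x) | x. True} \<union>
           {(x, infpt, neg_pt x, infpt) | x. True} \<union>
           {(infpt, y, infpt, neg_pt y) | y. True} \<and>
         diffeomorphic_to_circle {(x, inv_pt x, x, inv_pt x) | x. True} \<and>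
         diffeomorphic_to_circle {(x, infpt, neg_pt x, infpt) | x. True} \<and>
         diffeomorphic_to_circle {(infpt, y, infpt, neg_pt y) | y. True}"
proof (intro conjI)
  \<comment> \<open>These rules prove smoothness of each parametrisation after
    \<open>line_of_circle\<close>, one component at a time.\<close>
  note smooth_intros = smooth_map_on_euclidean_Pair smooth_map_on_inv_pt smooth_map_on_neg_pt
    smooth_map_on_infpt smooth_map_on_line_of_circle
  show "configurations \<alpha> \<beta> \<gamma> \<delta> =
           {(x, inv_pt x, x, inv_pt x) | x. True} \<union>
           {(x, infpt, neg_pt x, infpt) | x. True} \<union>
           {(infpt, y, infpt, neg_pt y) | y. True}"
    using configurations_rhombus[OF assms(1)] assms by simp
  show "diffeomorphic_to_circle {(x, inv_pt x, x, inv_pt x) | x. True}"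
    by (rule diffeomorphic_to_circleI[where pr = fst and h = "\<lambda>x. (x, inv_pt x, x, inv_pt x)"])
      (auto simp: line4_atlas_def intro!: smooth_intros smooth_map_on_line4_fst[unfolded line4_atlas_def])
  show "diffeomorphic_to_circle {(x, infpt, neg_pt x, infpt) | x. True}"
    by (rule diffeomorphic_to_circleI[where pr = fst and h = "\<lambda>x. (x, infpt, neg_pt x, infpt)"])
      (auto simp: line4_atlas_def intro!: smooth_intros smooth_map_on_line4_fst[unfolded line4_atlas_def])
  show "diffeomorphic_to_circle {(infpt, y, infpt, neg_pt y) | y. True}"
    \<comment> \<open>On this branch the first coordinate is constant, so the parameter is read off
      the second.\<close>
    by (rule diffeomorphic_to_circleI[where pr = "\<lambda>p. fst (snd p)" and
          h = "\<lambda>y. (infpt, y, infpt, neg_pt y)"])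
      (auto simp: line4_atlas_def intro!: smooth_intros smooth_map_on_line4_snd[unfolded line4_atlas_def])
qed

end
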